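(* Let $(L,[\cdot,\cdot,\cdot],\alpha,\beta)$ be a $3$-Bihom-Lie algebra over a field $\mathbb{K}$ and let $E$ be an almost product structure on $L$. If $$[x,y,z]=-[x,Ey,Ez]-[Ex,y,Ez]-[Ex,Ey,z]\quad\text{for all }x,y,z\in L,$$ then $E$ is a product structure on $L$.
   Context: A $3$-Bihom-Lie algebra over a field $\mathbb{K}$ is a $4$-tuple $(L,[\cdot,\cdot,\cdot],\alpha,\beta)$ consisting of a $\mathbb{K}$-vector space $L$, a $3$-linear map $[\cdot,\cdot,\cdot]\colon L\times L\times L\to L$ and two linear maps $\alpha,\beta\colon L\to L$ such that for all $x,y,z,u,v\in L$: (1) $\alpha\beta=\beta\alpha$; (2) $\alpha([x,y,z])=[\alpha(x),\alpha(y),\alpha(z)]$ and $\beta([x,y,z])=[\beta(x),\beta(y),\beta(z)]$; (3) $[\beta(x),\beta(y),\alpha(z)]=-[\beta(y),\beta(x),\alpha(z)]=-[\beta(x),\beta(z),\alpha(y)]$; (4) $[\beta^2(u),\beta^2(v),[\beta(x),\beta(y),\alpha(z)]]=[\beta^2(y),\beta^2(z),[\beta(u),\beta(v),\alpha(x)]]-[\beta^2(x),\beta^2(z),[\beta(u),\beta(v),\alpha(y)]]+[\beta^2(x),\beta^2(y),[\beta(u),\beta(v),\alpha(z)]]$. An almost product structure on $L$ is a linear map $E\colon L\to L$ with $E^2=\mathrm{Id}$, $E\neq\pm\mathrm{Id}$, $\alpha E=E\alpha$ and $\beta E=E\beta$. It is a product structure if for all $x,y,z\in L$, $$E[x,y,z]=[Ex,Ey,Ez]+[Ex,y,z]+[x,Ey,z]+[x,y,Ez]-E[Ex,Ey,z]-E[x,Ey,Ez]-E[Ex,y,Ez].$$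 *)

theory Defs
  imports Complex_Main
begin

definition trilinear ::
    "('k::field \<Rightarrow> 'v::ab_group_add \<Rightarrow> 'v) \<Rightarrow> ('v \<Rightarrow> 'v \<Rightarrow> 'v \<Rightarrow> 'v) \<Rightarrow> bool" where
  "trilinear scale br \<longleftrightarrow>
     (\<forall>y z. Vector_Spaces.linear scale scale (\<lambda>x. br x y z)) \<and>
     (\<forall>x z. Vector_Spaces.linear scale scale (\<lambda>y. br x y z)) \<and>
     (\<forall>x y. Vector_Spaces.linear scale scale (\<lambda>z. br x y z))"

text \<open>The underlying vector space \<open>L\<close> is the whole type \<open>'v\<close>, with scalar multiplication
  \<open>scale\<close> over an arbitrary field \<open>'k\<close>.\<close>

locale three_Bihom_Lie_algebra = vector_space scale
  for scale :: "'k::field \<Rightarrow> 'v::ab_group_add \<Rightarrow> 'v" +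
  fixes br :: "'v \<Rightarrow> 'v \<Rightarrow> 'v \<Rightarrow> 'v"
    and \<alpha> \<beta> :: "'v \<Rightarrow> 'v"
  assumes trilinear_br: "trilinear scale br"
    and linear_\<alpha>: "Vector_Spaces.linear scale scale \<alpha>"
    and linear_\<beta>: "Vector_Spaces.linear scale scale \<beta>"
    and \<alpha>_\<beta>_commute: "\<alpha> \<circ> \<beta> = \<beta> \<circ> \<alpha>"
    and \<alpha>_br: "\<alpha> (br x y z) = br (\<alpha> x) (\<alpha> y) (\<alpha> z)"
    and \<beta>_br: "\<beta> (br x y z) = br (\<beta> x) (\<beta> y) (\<beta> z)"
    and skew_12: "br (\<beta> x) (\<beta> y) (\<alpha> z) = - br (\<beta> y) (\<beta> x) (\<alpha> z)"
    and skew_23: "br (\<beta> x) (\<beta> y) (\<alpha> z) = - br (\<beta> x) (\<beta> z) (\<alpha> y)"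
    and Bihom_Jacobi:
      "br (\<beta> (\<beta> u)) (\<beta> (\<beta> v)) (br (\<beta> x) (\<beta> y) (\<alpha> z)) =
         br (\<beta> (\<beta> y)) (\<beta> (\<beta> z)) (br (\<beta> u) (\<beta> v) (\<alpha> x))
       - br (\<beta> (\<beta> x)) (\<beta> (\<beta> z)) (br (\<beta> u) (\<beta> v) (\<alpha> y))
       + br (\<beta> (\<beta> x)) (\<beta> (\<beta> y)) (br (\<beta> u) (\<beta> v) (\<alpha> z))"

definition almost_product_structure ::
    "('k::field \<Rightarrow> 'v::ab_group_add \<Rightarrow> 'v) \<Rightarrow> ('v \<Rightarrow> 'v) \<Rightarrow> ('v \<Rightarrow> 'v) \<Rightarrow> ('v \<Rightarrow> 'v) \<Rightarrow> bool" where
  "almost_product_structure scale \<alpha> \<beta> E \<longleftrightarrow>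
     Vector_Spaces.linear scale scale E \<and>
     E \<circ> E = id \<and> E \<noteq> id \<and> E \<noteq> (\<lambda>x. - x) \<and>
     \<alpha> \<circ> E = E \<circ> \<alpha> \<and> \<beta> \<circ> E = E \<circ> \<beta>"

definition product_structure ::
    "('k::field \<Rightarrow> 'v::ab_group_add \<Rightarrow> 'v) \<Rightarrow> ('v \<Rightarrow> 'v \<Rightarrow> 'v \<Rightarrow> 'v) \<Rightarrow>
     ('v \<Rightarrow> 'v) \<Rightarrow> ('v \<Rightarrow> 'v) \<Rightarrow> ('v \<Rightarrow> 'v) \<Rightarrow> bool" where
  "product_structure scale br \<alpha> \<beta> E \<longleftrightarrow>
     almost_product_structure scale \<alpha> \<beta> E \<and>
     (\<forall>x y z. E (br x y z) =
        br (E x) (E y) (E z) + br (E x) y z + br x (E y) z + br x y (E z)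
        - E (br (E x) (E y) z) - E (br x (E y) (E z)) - E (br (E x) y (E z)))"

end

theory Submission imports Defs begin

text \<open>Apply the hypothesis at \<open>(E x, E y, E z)\<close>: since \<open>E\<close> is an involution, the four terms of the
  product structure identity in which \<open>E\<close> acts only inside the bracket cancel.  What remains is
  the image of the hypothesis under \<open>E\<close>.\<close>

theorem proposition3p7:
  fixes scale :: "'k::field \<Rightarrow> 'v::ab_group_add \<Rightarrow> 'v"
    and br :: "'v \<Rightarrow> 'v \<Rightarrow> 'v \<Rightarrow> 'v"
    and \<alpha> \<beta> E :: "'v \<Rightarrow> 'v"
  assumes "three_Bihom_Lie_algebra scale br \<alpha> \<beta>"
    and "almost_product_structure scale \<alpha> \<beta> E"
    and "\<And>x y z. br x y z = - br x (E y) (E z) - br (E x) y (E z) - br (E x) (E y) z"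
  shows "product_structure scale br \<alpha> \<beta> E"
proof -
  have lin: "Vector_Spaces.linear scale scale E" and inv: "E (E x) = x" for x
    using assms(2) by (auto simp: almost_product_structure_def fun_eq_iff)
  interpret E: Vector_Spaces.linear scale scale E by (rule lin)
  have "E (br x y z) =
        br (E x) (E y) (E z) + br (E x) y z + br x (E y) z + br x y (E z)
        - E (br (E x) (E y) z) - E (br x (E y) (E z)) - E (br (E x) y (E z))" for x y z
  proof -
    \<comment> \<open>In each term on the right of the hypothesis two arguments acquire a second
      \<open>E\<close>, and \<open>E\<close> squared is the identity, so exactly one argument keeps
      an \<open>E\<close>.\<close>
    have "br (E x) (E y) (E z) = - br (E x) y z - br x (E y) z - br x y (E z)"
      using assms(3)[of "E x" "E y" "E z"] by (simp add: inv)
    moreover have "E (br x y z) =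
        - E (br x (E y) (E z)) - E (br (E x) y (E z)) - E (br (E x) (E y) z)"
      using arg_cong[OF assms(3)[of x y z], of E] by (simp only: E.diff E.neg)
    \<comment> \<open>The first equation makes the four terms without an outer \<open>E\<close> sum
      to zero; the right side of the second is, up to order, the other three.\<close>
    ultimately show ?thesis by simp
  qed
  then show ?thesis
    using assms(2) unfolding product_structure_def by blast
qed

end
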